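(* Work with hereditarily finite sets built over a single atom $\heartsuit$, and for a set $M$ put $M_L=\{A: A\in M,\ \heartsuit\notin A\}$ and $M_R=\{A: A\cup\{\heartsuit\}\in M,\ \heartsuit\notin A\}$. Let $\mathcal P_\in$ be the class of finite sets $M$ defined recursively by: $\heartsuit\notin M$, $M_L\cup M_R\subseteq\mathcal P_\in$, $M_L\cap M_R=\emptyset$; $(\{A\}\cup A_R)\cap(\{B\}\cup B_L)\neq\emptyset$ for each $A\in M_L$, $B\in M_R$; $A_L\subseteq M_L$ for each $A\in M_L$; $B_R\subseteq M_R$ for each $B\in M_R$. For $A,B\in\mathcal P_\in$ write $A<_\in B$ if $(\{A\}\cup A_R)\cap(\{B\}\cup B_L)\neq\emptyset$. Define recursively $A\le_{\mathbb S} B$ if and only if there is no $l\in A_L$ with $B\le_{\mathbb S} l$ and no $r\in B_R$ with $r\le_{\mathbb S} A$, and write $A<_{\mathbb S}B$ if $A\le_{\mathbb S}B$ and not $B\le_{\mathbb S}A$. Then for all $A,B\in\mathcal P_\in$, $A<_\in B$ implies $A<_{\mathbb S} B$.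
   Context: The relation $\le_{\mathbb S}$ is the restriction of Conway's order on surreal numbers, viewing $A$ as the surreal number $\{A_L\mid A_R\}$.
   Formalization: The formal theorem assumes in addition that A and B are distinct: as displayed, A <_∈ A holds for every A (for instance A = ∅) while A <_S A never does, so the claim fails exactly when A = B. *)

theory Defs
  imports "HOL-Library.FSet"
begin

text \<open>
  An object of the universe is either the atom or a hereditarily finite set; the sets themselves
  are represented by their (finite) extensions, of type \<open>hfset\<close>.
\<close>

datatype hfobj = Heart | HSet "hfobj fset"

type_synonym hfset = "hfobj fset"

definition left_opts :: "hfset \<Rightarrow> hfset set" where
  "left_opts M = {A. HSet A |\<in>| M \<and> Heart |\<notin>| A}"

definition right_opts :: "hfset \<Rightarrow> hfset set" where
  "right_opts M = {A. HSet (finsert Heart A) |\<in>| M \<and> Heart |\<notin>| A}"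

text \<open>
  This is the relation as displayed in the source. Read literally it is reflexive
  (see \<open>lt_in_refl\<close> below), so it is only meant as a strict order between distinct sets.
\<close>

definition lt_in :: "hfset \<Rightarrow> hfset \<Rightarrow> bool"  (infix "<\<^sub>\<in>" 50) where
  "A <\<^sub>\<in> B \<longleftrightarrow> ({A} \<union> right_opts A) \<inter> ({B} \<union> left_opts B) \<noteq> {}"

text \<open>
  The options of a set have smaller rank, so the recursive specification of the class has exactly
  one solution, and the least one taken here is that solution.
\<close>

inductive_set P_in :: "hfset set" where
  "Heart |\<notin>| M \<Longrightarrow>
   \<forall>A \<in> left_opts M \<union> right_opts M. A \<in> P_in \<Longrightarrow>
   left_opts M \<inter> right_opts M = {} \<Longrightarrow>
   \<forall>A \<in> left_opts M. \<forall>B \<in> right_opts M. A <\<^sub>\<in> B \<Longrightarrow>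
   \<forall>A \<in> left_opts M. left_opts A \<subseteq> left_opts M \<Longrightarrow>
   \<forall>B \<in> right_opts M. right_opts B \<subseteq> right_opts M \<Longrightarrow>
   M \<in> P_in"

definition hsize :: "hfset \<Rightarrow> nat" where
  "hsize M = (\<Sum>x \<in> fset M. Suc (size x))"

lemma hsize_opt:
  assumes "HSet X |\<in>| M" and "A |\<subseteq>| X"
  shows "hsize A < hsize M"
proof -
  have "hsize A \<le> hsize X"
    unfolding hsize_def using assms(2)
    by (intro sum_mono2) (auto simp: less_eq_fset.rep_eq)
  also have "\<dots> < Suc (size (HSet X))"
    by (simp add: hsize_def)
  also have "\<dots> \<le> hsize M"
    unfolding hsize_def using assms(1)
    by (intro member_le_sum[where f = "\<lambda>x. Suc (size x)"]) auto
  finally show ?thesis .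
qed

lemma hsize_left_opts: "A \<in> left_opts M \<Longrightarrow> hsize A < hsize M"
  by (auto simp: left_opts_def intro: hsize_opt)

lemma hsize_right_opts: "A \<in> right_opts M \<Longrightarrow> hsize A < hsize M"
  by (auto simp: right_opts_def intro: hsize_opt)

text \<open>Conway's order; it makes sense for all sets, not just for those in \<open>P_in\<close>.\<close>

function le_S :: "hfset \<Rightarrow> hfset \<Rightarrow> bool"  (infix "\<le>\<^sub>S" 50) where
  "A \<le>\<^sub>S B \<longleftrightarrow>
     \<not> (\<exists>l \<in> left_opts A. B \<le>\<^sub>S l) \<and> \<not> (\<exists>r \<in> right_opts B. r \<le>\<^sub>S A)"
  by auto
termination
  by (relation "measure (\<lambda>(A, B). hsize A + hsize B)")
     (auto dest: hsize_left_opts hsize_right_opts)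

declare le_S.simps [simp del]

definition lt_S :: "hfset \<Rightarrow> hfset \<Rightarrow> bool"  (infix "<\<^sub>S" 50) where
  "A <\<^sub>S B \<longleftrightarrow> A \<le>\<^sub>S B \<and> \<not> B \<le>\<^sub>S A"

text \<open>
  The literal relation and \<open>lt_S\<close> disagree on the diagonal, already at the empty set;
  hence the main statement is about distinct sets.
\<close>

lemma lt_in_refl: "A <\<^sub>\<in> A"
  by (simp add: lt_in_def)

lemma lt_S_irrefl: "\<not> A <\<^sub>S A"
  by (simp add: lt_S_def)

lemma empty_in_P_in: "{||} \<in> P_in"
  by (rule P_in.intros) (auto simp: left_opts_def right_opts_def)

end

theory Submission imports Defs begin

text \<open>
  Conway's order is reflexive and transitive on all games, so the claim reduces to the inequalities
  \<open>l <\<^sub>S M <\<^sub>S r\<close> between \<open>M \<in> P_in\<close> and its options. For \<open>l <\<^sub>S M\<close>, transitivity of left options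
  excludes \<open>M \<le>\<^sub>S l'\<close> for \<open>l'\<close> a left option of \<open>l\<close>, and \<open>l <\<^sub>\<in> r\<close> excludes \<open>r \<le>\<^sub>S l\<close> by induction.
\<close>

text \<open>By induction an option \<open>l\<close> satisfies \<open>l \<le>\<^sub>S l\<close>, and
  this alone forbids \<open>A \<le>\<^sub>S l\<close>; right options are dual.\<close>

lemma le_S_refl: "A \<le>\<^sub>S A"
proof (induction "hsize A" arbitrary: A rule: less_induct)
  case less
  have "\<not> A \<le>\<^sub>S l" if "l \<in> left_opts A" for l
    using that less[OF hsize_left_opts] le_S.simps[of A l] by blast
  moreover have "\<not> r \<le>\<^sub>S A" if "r \<in> right_opts A" for r
    using that less[OF hsize_right_opts] le_S.simps[of r A] by blast
  ultimately show ?case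
    by (subst le_S.simps) blast
qed

lemma le_S_trans: "A \<le>\<^sub>S B \<Longrightarrow> B \<le>\<^sub>S C \<Longrightarrow> A \<le>\<^sub>S C"
\<comment> \<open>Passing to an option rotates the triple to \<open>B, C, l\<close> or
  \<open>r, A, B\<close>; the sum of sizes is insensitive to this.\<close>
proof (induction "hsize A + hsize B + hsize C" arbitrary: A B C rule: less_induct)
  case less
  have "\<not> C \<le>\<^sub>S l" if l: "l \<in> left_opts A" for l
  proof
    assume "C \<le>\<^sub>S l"
    with less.prems(2) have "B \<le>\<^sub>S l"
      using less.hyps[of B C l] hsize_left_opts[OF l] by simp
    with less.prems(1) l show False
      by (auto simp: le_S.simps[of A B])
  qed
  moreover have "\<not> r \<le>\<^sub>S A" if r: "r \<in> right_opts C" for r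
  proof
    assume "r \<le>\<^sub>S A"
    with less.prems(1) have "r \<le>\<^sub>S B"
      using less.hyps[of r A B] hsize_right_opts[OF r] by simp
    with less.prems(2) r show False
      by (auto simp: le_S.simps[of B C])
  qed
  ultimately show ?case
    by (subst le_S.simps) blast
qed

lemma lt_S_trans: "A <\<^sub>S B \<Longrightarrow> B <\<^sub>S C \<Longrightarrow> A <\<^sub>S C"
  unfolding lt_S_def using le_S_trans by blast

lemma not_le_S_left_opts: "l \<in> left_opts A \<Longrightarrow> \<not> A \<le>\<^sub>S l"
  using le_S_refl[of l] le_S.simps[of A l] by blast

lemma not_le_S_right_opts: "r \<in> right_opts A \<Longrightarrow> \<not> r \<le>\<^sub>S A"
  using le_S_refl[of r] le_S.simps[of r A] by blast

text \<open>The option inequalities are premises so that the induction hypothesis can supply them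
  for options \<open>l\<close>, \<open>r\<close> of a larger set.\<close>

lemma lt_in_imp_lt_S:
  assumes right: "\<And>r. r \<in> right_opts A \<Longrightarrow> A <\<^sub>S r"
    and left: "\<And>l. l \<in> left_opts B \<Longrightarrow> l <\<^sub>S B"
    and "A \<noteq> B" and "A <\<^sub>\<in> B"
  shows "A <\<^sub>S B"
proof -
  obtain C where C: "C = A \<or> C \<in> right_opts A" "C = B \<or> C \<in> left_opts B"
    using \<open>A <\<^sub>\<in> B\<close> unfolding lt_in_def by auto
  \<comment> \<open>As \<open>A \<noteq> B\<close>, a \<open>C\<close> equal to one end is an option
    of the other; otherwise \<open>C\<close> lies strictly between.\<close>
  show ?thesis
  proof (cases "C = A \<or> C = B")
    case True
    then show ?thesis
      using C \<open>A \<noteq> B\<close> left right by auto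
  next
    case False
    then show ?thesis
      using C left right lt_S_trans by metis
  qed
qed

lemma P_in_lt_S_opts:
  assumes "M \<in> P_in"
  shows "(\<forall>l \<in> left_opts M. l <\<^sub>S M) \<and> (\<forall>r \<in> right_opts M. M <\<^sub>S r)"
  using assms
proof (induction M rule: P_in.induct)
  case (1 M)
  have lr: "\<not> r \<le>\<^sub>S l" if l: "l \<in> left_opts M" and r: "r \<in> right_opts M" for l r
  proof -
    have "l <\<^sub>S r"
    proof (rule lt_in_imp_lt_S)
      show "l <\<^sub>S s" if "s \<in> right_opts l" for s
        using "1.IH" l that by simp
      show "s <\<^sub>S r" if "s \<in> left_opts r" for s
        using "1.IH" r that by simp
      \<comment> \<open>Left and right options of \<open>M\<close> are disjoint.\<close>
      show "l \<noteq> r"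
        using "1.hyps"(2) l r by auto
      show "l <\<^sub>\<in> r"
        using "1.hyps"(3) l r by simp
    qed
    then show ?thesis
      by (simp add: lt_S_def)
  qed
  have "l \<le>\<^sub>S M" if l: "l \<in> left_opts M" for l
  proof -
    \<comment> \<open>Such an \<open>s\<close> is itself a left option of \<open>M\<close>. The
      other obstruction to \<open>l \<le>\<^sub>S M\<close>, a right option of \<open>M\<close>
      below \<open>l\<close>, is excluded by \<open>lr\<close>.\<close>
    have "\<not> M \<le>\<^sub>S s" if "s \<in> left_opts l" for s
      using "1.hyps"(4) l that by (auto intro!: not_le_S_left_opts)
    then show ?thesis
      using l lr by (simp add: le_S.simps[of l M])
  qed
  moreover have "M \<le>\<^sub>S r" if r: "r \<in> right_opts M" for r
  proof -
    have "\<not> s \<le>\<^sub>S M" if "s \<in> right_opts r" for s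
      using "1.hyps"(5) r that by (auto intro!: not_le_S_right_opts)
    then show ?thesis
      using r lr by (simp add: le_S.simps[of M r])
  qed
  ultimately show ?case
    by (simp add: lt_S_def not_le_S_left_opts not_le_S_right_opts)
qed

theorem theorem3p19:
  fixes A B :: hfset
  assumes "A \<in> P_in" and "B \<in> P_in" and "A \<noteq> B" and "A <\<^sub>\<in> B"
  shows "A <\<^sub>S B"
  by (rule lt_in_imp_lt_S) (simp_all add: assms P_in_lt_S_opts)

end
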